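(* For $n\ge 1$ and integers $i,j$, let $\overline{b}_{n,i,j}$ be the number of $\pi\in\mathfrak{B}_n$ with $\operatorname{des}^B(\pi)=i$ and $\operatorname{ides}^B(\pi)=j$ (so $\overline{b}_{n,i,j}=0$ if $i<0$ or $j<0$). Then $\overline{b}_{1,0,0}=\overline{b}_{1,1,1}=1$, $\overline{b}_{1,0,1}=\overline{b}_{1,1,0}=0$, and for all $n\ge 2$ and $0\le i,j\le n$, \[ \begin{aligned} n\,\overline{b}_{n,i,j}={}&(n+i+j+2ij)\,\overline{b}_{n-1,i,j}+\big((2n-1)i-(2i+1)(j-1)\big)\,\overline{b}_{n-1,i,j-1}\\ &+\big((2n-1)j-(2j+1)(i-1)\big)\,\overline{b}_{n-1,i-1,j}\\ &+\big((2n^2-n)+2(i-1)(j-1)+(1-2n)(i+j-2)\big)\,\overline{b}_{n-1,i-1,j-1}. \end{aligned} \]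
   Context: For a positive integer $n$, $\mathfrak{B}_n$ is the set of signed permutations of length $n$: words $\pi=\pi_1\cdots\pi_n$ with $\pi_i\in\{\pm1,\dots,\pm n\}$ such that $|\pi_1|,\dots,|\pi_n|$ is a permutation of $[n]=\{1,\dots,n\}$. Set $\pi_0=0$. The inverse $\pi^{-1}\in\mathfrak{B}_n$ is defined by $\pi^{-1}_{|\pi_i|}=\operatorname{sgn}(\pi_i)\,i$. With the natural order $\cdots<-2<-1<0<1<2<\cdots$ on $\mathbb{Z}$, define $\operatorname{des}^B(\pi)=|\{i\in\{0,1,\dots,n-1\}:\pi_i>\pi_{i+1}\}|$ and $\operatorname{ides}^B(\pi)=\operatorname{des}^B(\pi^{-1})$. *)

theory Defs
  imports "HOL-Combinatorics.Multiset_Permutations"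
begin

text \<open>A word \<open>\<pi> = \<pi>\<^sub>1 \<dots> \<pi>\<^sub>n\<close> is a list of integers.  That \<open>\<pi>\<close> has length \<open>n\<close> and letters in
  \<open>{\<plusminus>1, \<dots>, \<plusminus>n}\<close> follows from the condition on the absolute values.\<close>

definition signed_perms :: "nat \<Rightarrow> int list set" where
  "signed_perms n = {\<pi>. map abs \<pi> \<in> permutations_of_set {1..int n}}"

text \<open>Letters are counted from 1 and \<open>\<pi>\<^sub>0 = 0\<close>, so list position \<open>i - 1\<close> holds \<open>\<pi>\<^sub>i\<close>.\<close>

definition letter :: "int list \<Rightarrow> nat \<Rightarrow> int" where
  "letter \<pi> i = (0 # \<pi>) ! i"

definition desB :: "int list \<Rightarrow> nat" where
  "desB \<pi> = card {i \<in> {0..<length \<pi>}. letter \<pi> i > letter \<pi> (i + 1)}"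

text \<open>The description is proper for signed permutations: see \<open>sperm_inverse_ex1\<close> below.\<close>

definition sperm_inverse :: "int list \<Rightarrow> int list" where
  "sperm_inverse \<pi> = (THE \<sigma>. \<sigma> \<in> signed_perms (length \<pi>) \<and>
     (\<forall>i\<in>{1..length \<pi>}. letter \<sigma> (nat \<bar>letter \<pi> i\<bar>) = sgn (letter \<pi> i) * int i))"

definition idesB :: "int list \<Rightarrow> nat" where
  "idesB \<pi> = desB (sperm_inverse \<pi>)"

definition bbar :: "nat \<Rightarrow> int \<Rightarrow> int \<Rightarrow> int" where
  "bbar n i j = int (card {\<pi> \<in> signed_perms n. int (desB \<pi>) = i \<and> int (idesB \<pi>) = j})"

lemma signed_perms_length: "\<pi> \<in> signed_perms n \<Longrightarrow> length \<pi> = n"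
  using length_finite_permutations_of_set[of "map abs \<pi>" "{1..int n}"]
  by (simp add: signed_perms_def)

lemma signed_perms_letters:
  assumes "\<pi> \<in> signed_perms n" "x \<in> set \<pi>"
  shows "x \<in> {- int n..-1} \<union> {1..int n}"
proof -
  have "abs ` set \<pi> = {1..int n}"
    using assms(1) by (simp add: signed_perms_def permutations_of_set_def)
  then have "\<bar>x\<bar> \<in> {1..int n}" using assms(2) by blast
  then show ?thesis by auto
qed

lemma finite_signed_perms: "finite (signed_perms n)"
proof (rule finite_subset)
  show "signed_perms n \<subseteq> {\<pi>. set \<pi> \<subseteq> {- int n..-1} \<union> {1..int n} \<and> length \<pi> = n}"
    using signed_perms_length signed_perms_letters by fast
qed (rule finite_lists_length_eq, simp)

lemma sperm_inverse_ex1: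
  assumes "\<pi> \<in> signed_perms n"
  shows "\<exists>!\<sigma>. \<sigma> \<in> signed_perms n \<and>
     (\<forall>i\<in>{1..n}. letter \<sigma> (nat \<bar>letter \<pi> i\<bar>) = sgn (letter \<pi> i) * int i)"
proof -
  have len: "length \<pi> = n" using assms by (rule signed_perms_length)
  have st: "abs ` set \<pi> = {1..int n}" and dist: "distinct (map abs \<pi>)"
    using assms by (simp_all add: signed_perms_def permutations_of_set_def)
  define g where "g i = nat \<bar>letter \<pi> i\<bar>" for i
  have lt: "letter \<pi> i = \<pi> ! (i - 1)" if "i \<in> {1..n}" for i
    using that by (simp add: letter_def)
  have g1: "g i \<in> {1..n}" if "i \<in> {1..n}" for i
  proof -
    have "\<bar>letter \<pi> i\<bar> \<in> abs ` set \<pi>" using that lt[OF that] len by auto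
    then show ?thesis unfolding st g_def by auto
  qed
  have inj: "inj_on g {1..n}"
  proof (rule inj_onI)
    fix i j assume ij: "i \<in> {1..n}" "j \<in> {1..n}" "g i = g j"
    then have "map abs \<pi> ! (i - 1) = map abs \<pi> ! (j - 1)"
      using len by (auto simp: g_def lt eq_nat_nat_iff)
    then have "i - 1 = j - 1"
      using nth_eq_iff_index_eq[OF dist, of "i - 1" "j - 1"] ij(1,2) len by auto
    then show "i = j" using ij by auto
  qed
  have img: "g ` {1..n} = {1..n}"
    using inj g1 by (intro endo_inj_surj) auto
  define h where "h = inv_into {1..n} g"
  have h: "h k \<in> {1..n}" "g (h k) = k" if "k \<in> {1..n}" for k
    using that img inv_into_into[of k g "{1..n}"] f_inv_into_f[of k g "{1..n}"]
    by (simp_all add: h_def)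
  have hg: "h (g i) = i" if "i \<in> {1..n}" for i
    using that inj by (simp add: h_def)
  have himg: "h ` {1..n} = {1..n}"
  proof
    show "h ` {1..n} \<subseteq> {1..n}" using h(1) by blast
    show "{1..n} \<subseteq> h ` {1..n}"
    proof
      fix i assume i: "i \<in> {1..n}"
      show "i \<in> h ` {1..n}" using imageI[OF g1[OF i], of h] hg[OF i] by simp
    qed
  qed
  have injh: "inj_on h {1..n}" by (rule inj_on_inverseI[of _ g]) (rule h(2))
  have nz: "letter \<pi> i \<noteq> 0" if "i \<in> {1..n}" for i
    using g1[OF that] by (auto simp: g_def)
  define \<sigma> where "\<sigma> = map (\<lambda>k. sgn (letter \<pi> (h k)) * int (h k)) [1..<Suc n]"
  have absm: "map abs \<sigma> = map (\<lambda>k. int (h k)) [1..<Suc n]"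
    unfolding \<sigma>_def map_map
  proof (rule map_cong[OF refl])
    fix k assume "k \<in> set [1..<Suc n]"
    then have "k \<in> {1..n}" by auto
    then show "(abs \<circ> (\<lambda>k. sgn (letter \<pi> (h k)) * int (h k))) k = int (h k)"
      using nz[OF h(1)] by (simp add: abs_mult abs_sgn_eq)
  qed
  have S: "set [1..<Suc n] = {1..n}" by auto
  have "set (map abs \<sigma>) = int ` (h ` {1..n})"
    unfolding absm set_map S by auto
  also have "\<dots> = {1..int n}"
    unfolding himg image_int_atLeastAtMost by simp
  finally have c1: "set (map abs \<sigma>) = {1..int n}" .
  have "inj_on (int \<circ> h) {1..n}"
    by (rule comp_inj_on[OF injh]) (rule inj_on_of_nat)
  then have "inj_on (\<lambda>k. int (h k)) (set [1..<Suc n])"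
    unfolding S comp_def .
  then have c2: "distinct (map abs \<sigma>)"
    unfolding absm distinct_map by (rule conjI[OF distinct_upt])
  have mem: "\<sigma> \<in> signed_perms n"
    using c1 c2 by (simp add: signed_perms_def permutations_of_set_def)
  have lets: "letter \<sigma> k = sgn (letter \<pi> (h k)) * int (h k)" if "k \<in> {1..n}" for k
    using that by (auto simp: letter_def \<sigma>_def nth_Cons' simp del: upt_Suc)
  show ?thesis
  proof (rule ex1I[of _ \<sigma>])
    show "\<sigma> \<in> signed_perms n \<and>
      (\<forall>i\<in>{1..n}. letter \<sigma> (nat \<bar>letter \<pi> i\<bar>) = sgn (letter \<pi> i) * int i)"
      using mem lets g1 hg by (simp add: g_def)
  next
    fix \<tau> assume t: "\<tau> \<in> signed_perms n \<and>
      (\<forall>i\<in>{1..n}. letter \<tau> (nat \<bar>letter \<pi> i\<bar>) = sgn (letter \<pi> i) * int i)"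
    have tl: "letter \<tau> k = letter \<sigma> k" if "k \<in> {1..n}" for k
      using conjunct2[OF t] h[OF that] lets[OF that] by (force simp: g_def)
    show "\<tau> = \<sigma>"
    proof (rule nth_equalityI)
      show "length \<tau> = length \<sigma>"
        using signed_perms_length[OF conjunct1[OF t]] signed_perms_length[OF mem] by simp
    next
      fix k assume "k < length \<tau>"
      then have "Suc k \<in> {1..n}"
        using signed_perms_length[OF conjunct1[OF t]] by simp
      from tl[OF this] show "\<tau> ! k = \<sigma> ! k" by (simp add: letter_def)
    qed
  qed
qed

lemma bbar_eq_0: "i < 0 \<or> j < 0 \<Longrightarrow> bbar n i j = 0"
  by (auto simp: bbar_def)

end

theory Submission
  imports Defs
begin

text \<open>Deleting one letter of a signed permutation of length \<open>n\<close> and standardizing pairs the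
  \<open>n |B\<^sub>n|\<close> marked permutations with the triples of a \<open>\<sigma>\<close> of length \<open>n - 1\<close>, a position and a
  signed value at which a letter is inserted into \<open>\<sigma>\<close>.  An insertion raises each of \<open>des\<^sup>B\<close> and
  \<open>ides\<^sup>B\<close> by \<open>0\<close> or \<open>1\<close>, and the coefficients of the recurrence count, for every single \<open>\<sigma>\<close> with
  \<open>des\<^sup>B \<sigma> = i\<close> and \<open>ides\<^sup>B \<sigma> = j\<close>, the insertions with each of the four possible effects.  Up to
  a term that depends only on the position, the increment of \<open>des\<^sup>B\<close> is a difference, along
  positions, of indicators of \<open>\<sigma>\<^sub>p\<close> lying below the inserted value; the increment of \<open>ides\<^sup>B\<close> is the
  same with \<open>\<sigma>\<close> inverted.  So the sums of the increments over all insertions telescope, and so does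
  the sum of their product, because both families of indicators jump exactly at the entries of
  the matrix of \<open>\<sigma>\<close>.\<close>

section \<open>Inserting a letter into a signed permutation\<close>

text \<open>Opens a gap at absolute value \<open>q + 1\<close> and keeps all signs; this undoes the
  standardization after a deletion.\<close>

definition stretch :: "nat \<Rightarrow> int \<Rightarrow> int" where
  "stretch q x = (if int q < \<bar>x\<bar> then x + sgn x else x)"

text \<open>Both \<open>p\<close> and \<open>q\<close> count what lies below the new entry, namely
  the letters before it and the smaller absolute values, so that inversion simply exchanges
  them.\<close>

definition insert_dot :: "int list \<Rightarrow> nat \<Rightarrow> nat \<Rightarrow> int \<Rightarrow> int list" where
  "insert_dot \<sigma> p q s =
     take p (map (stretch q) \<sigma>) @ s * int (Suc q) # drop p (map (stretch q) \<sigma>)"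

lemma stretch_0 [simp]: "stretch q 0 = 0"
  by (simp add: stretch_def)

lemma strict_mono_stretch: "strict_mono (stretch q)"
  by (rule strict_monoI) (auto simp: stretch_def sgn_if)

lemma sgn_stretch [simp]: "sgn (stretch q x) = sgn x"
  by (auto simp: stretch_def sgn_if)

lemma abs_stretch: "\<bar>stretch q x\<bar> = (if int q < \<bar>x\<bar> then \<bar>x\<bar> + 1 else \<bar>x\<bar>)"
  by (auto simp: stretch_def sgn_if)

text \<open>Pigeonhole: \<open>n\<close> distinct absolute values inside \<open>{1..int n}\<close>
  exhaust it, so an inclusion suffices to prove membership.\<close>

lemma signed_perms_iff:
  "\<pi> \<in> signed_perms n \<longleftrightarrow>
     length \<pi> = n \<and> distinct (map abs \<pi>) \<and> abs ` set \<pi> \<subseteq> {1..int n}"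
proof
  assume "\<pi> \<in> signed_perms n"
  then show "length \<pi> = n \<and> distinct (map abs \<pi>) \<and> abs ` set \<pi> \<subseteq> {1..int n}"
    using signed_perms_length by (auto simp: signed_perms_def permutations_of_set_def)
next
  assume *: "length \<pi> = n \<and> distinct (map abs \<pi>) \<and> abs ` set \<pi> \<subseteq> {1..int n}"
  then have "card (abs ` set \<pi>) = n"
    using distinct_card[of "map abs \<pi>"] by simp
  then have "abs ` set \<pi> = {1..int n}"
    using * by (intro card_subset_eq) auto
  with * show "\<pi> \<in> signed_perms n"
    by (simp add: signed_perms_def permutations_of_set_def)
qed

lemma set_insert_dot:
  "set (insert_dot \<sigma> p q s) = insert (s * int (Suc q)) (stretch q ` set \<sigma>)"
proof -
  have "set (take p (map (stretch q) \<sigma>)) \<union> set (drop p (map (stretch q) \<sigma>))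
      = set (map (stretch q) \<sigma>)"
    by (metis append_take_drop_id set_append)
  then show ?thesis by (auto simp: insert_dot_def)
qed

lemma insert_dot_signed_perms:
  assumes "\<sigma> \<in> signed_perms m" "q \<le> m" "\<bar>s\<bar> = 1"
  shows "insert_dot \<sigma> p q s \<in> signed_perms (Suc m)"
proof -
  define \<rho> where "\<rho> = map (stretch q) \<sigma>"
  have \<sigma>: "length \<sigma> = m" "distinct (map abs \<sigma>)" "abs ` set \<sigma> \<subseteq> {1..int m}"
    using assms(1) by (auto simp: signed_perms_iff)
  have "map abs \<rho> = map (\<lambda>x. if int q < x then x + 1 else x) (map abs \<sigma>)"
    by (simp add: \<rho>_def abs_stretch)
  moreover have "inj_on (\<lambda>x::int. if int q < x then x + 1 else x) A" for A
    by (rule inj_onI) (auto split: if_splits)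
  ultimately have d: "distinct (map abs \<rho>)"
    using \<sigma>(2) by (simp only: distinct_map)
  have notin: "int (Suc q) \<notin> abs ` set \<rho>"
    by (auto simp: \<rho>_def abs_stretch split: if_splits)
  have "abs (s * int (Suc q)) = int (Suc q)"
    using assms(3) by (simp add: abs_mult)
  moreover have "distinct (map abs (take p \<rho> @ drop p \<rho>))"
    using d by simp
  moreover have "set (take p \<rho>) \<union> set (drop p \<rho>) = set \<rho>"
    by (metis append_take_drop_id set_append)
  ultimately have "distinct (map abs (insert_dot \<sigma> p q s))"
    using notin by (auto simp: insert_dot_def \<rho>_def[symmetric] simp del: append_take_drop_id)
  moreover have "length (insert_dot \<sigma> p q s) = Suc m"
    using \<sigma>(1) by (simp add: insert_dot_def)
  moreover have "abs ` set (insert_dot \<sigma> p q s) \<subseteq> {1..int (Suc m)}"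
    using \<sigma>(3) assms(2,3) by (fastforce simp: set_insert_dot abs_mult abs_stretch)
  ultimately show ?thesis by (simp add: signed_perms_iff)
qed

lemma length_insert_dot [simp]: "length (insert_dot \<sigma> p q s) = Suc (length \<sigma>)"
  by (simp add: insert_dot_def)

text \<open>The position of the new letter is kept as the mark. The marked letter then reveals
  \<open>q\<close> and \<open>s\<close>, and \<open>stretch q\<close> can be undone on all other
  letters.\<close>

lemma bij_betw_insert_dot:
  "bij_betw (\<lambda>(\<sigma>, p, q, s). (insert_dot \<sigma> p q s, p))
     (signed_perms m \<times> {..m} \<times> {..m} \<times> {1, -1}) (signed_perms (Suc m) \<times> {..m})"
  unfolding bij_betw_def
proof
  let ?f = "\<lambda>(\<sigma>, p, q, s). (insert_dot \<sigma> p q s, p)"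
  let ?A = "signed_perms m \<times> {..m} \<times> {..m} \<times> {1, -1::int}"
  show "inj_on ?f ?A"
  proof (rule inj_onI, clarify)
    fix \<sigma> \<sigma>' p q q' and s s' :: int
    assume \<sigma>: "\<sigma> \<in> signed_perms m" "\<sigma>' \<in> signed_perms m" and "p \<le> m"
      and s: "s \<in> {1, -1}" "s' \<in> {1, -1}"
      and eq: "insert_dot \<sigma> p q s = insert_dot \<sigma>' p q' s'"
    have len: "length \<sigma> = m" "length \<sigma>' = m"
      using \<sigma> by (auto simp: signed_perms_iff)
    have *: "take p (map (stretch q) \<sigma>) = take p (map (stretch q') \<sigma>')"
      "s * int (Suc q) = s' * int (Suc q')"
      "drop p (map (stretch q) \<sigma>) = drop p (map (stretch q') \<sigma>')"
      using eq len by (simp_all add: insert_dot_def)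
    from *(2) s have "s = s'" "q = q'" by auto
    moreover from * have "map (stretch q) \<sigma> = map (stretch q') \<sigma>'"
      by (metis append_take_drop_id)
    ultimately have "map (stretch q) \<sigma> = map (stretch q) \<sigma>'" by simp
    then have "\<sigma> = \<sigma>'"
      using strict_mono_imp_inj_on[OF strict_mono_stretch] by (metis inj_map_eq_map)
    with \<open>s = s'\<close> \<open>q = q'\<close> show "\<sigma> = \<sigma>' \<and> (p, q, s) = (p, q', s')" by simp
  qed
  show "?f ` ?A = signed_perms (Suc m) \<times> {..m}"
  proof
    show "?f ` ?A \<subseteq> signed_perms (Suc m) \<times> {..m}"
      using insert_dot_signed_perms by auto
    show "signed_perms (Suc m) \<times> {..m} \<subseteq> ?f ` ?A"
    proof clarify
      fix \<pi> p assume \<pi>: "\<pi> \<in> signed_perms (Suc m)" and p: "p \<le> m"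
      have len: "length \<pi> = Suc m" and dist: "distinct (map abs \<pi>)"
        and sub: "abs ` set \<pi> \<subseteq> {1..int (Suc m)}"
        using \<pi> by (auto simp: signed_perms_iff)
      define v where "v = \<pi> ! p"
      define q where "q = nat \<bar>v\<bar> - 1"
      define \<rho> where "\<rho> = take p \<pi> @ drop (Suc p) \<pi>"
      define u where "u x = (if int q < \<bar>x\<bar> then x - sgn x else x)" for x
      have \<pi>_eq: "\<pi> = take p \<pi> @ v # drop (Suc p) \<pi>"
        using p len by (simp add: v_def id_take_nth_drop)
      have set_\<pi>: "set \<pi> = insert v (set \<rho>)"
        by (subst \<pi>_eq) (auto simp: \<rho>_def)
      have "distinct (map abs (take p \<pi> @ v # drop (Suc p) \<pi>))"
        using dist \<pi>_eq by simp
      then have d\<rho>: "distinct (map abs \<rho>)" and notin: "\<bar>v\<bar> \<notin> abs ` set \<rho>"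
        by (auto simp: \<rho>_def)
      have v: "1 \<le> \<bar>v\<bar>" "\<bar>v\<bar> \<le> int (Suc m)" "\<bar>v\<bar> = int (Suc q)"
        using sub set_\<pi> by (auto simp: q_def)
      have qm: "q \<le> m" using v by simp
      have x: "1 \<le> \<bar>x\<bar>" "\<bar>x\<bar> \<le> int (Suc m)" "\<bar>x\<bar> \<noteq> int (Suc q)" if "x \<in> set \<rho>" for x
        using that sub set_\<pi> notin v(3) by (auto simp del: of_nat_Suc) (metis imageI)
      have su: "stretch q (u x) = x" if "x \<in> set \<rho>" for x
        using x[OF that] by (auto simp: stretch_def u_def sgn_if)
      have au: "\<bar>u x\<bar> = (if int q < \<bar>x\<bar> then \<bar>x\<bar> - 1 else \<bar>x\<bar>)" if "x \<in> set \<rho>" for x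
        using x[OF that] by (auto simp: u_def sgn_if)
      \<comment> \<open>The two cases of \<open>au\<close> cannot meet: an unshifted value is at
        most \<open>q\<close>, a shifted one at least \<open>q + 1\<close>, because no letter of
        \<open>\<rho>\<close> has absolute value \<open>q + 1\<close>.\<close>
      have "inj_on (\<lambda>x. \<bar>u x\<bar>) (set \<rho>)"
      proof (rule inj_onI)
        fix y z assume yz: "y \<in> set \<rho>" "z \<in> set \<rho>" "\<bar>u y\<bar> = \<bar>u z\<bar>"
        then have "\<bar>y\<bar> = \<bar>z\<bar>"
          using x[OF yz(1)] x[OF yz(2)] by (auto simp: au split: if_splits)
        then show "y = z" using d\<rho> yz by (auto simp: distinct_map inj_on_def)
      qed
      moreover have "distinct \<rho>" using d\<rho> by (simp add: distinct_map)
      ultimately have "distinct (map abs (map u \<rho>))"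
        by (simp add: distinct_map comp_def inj_on_def)
      moreover have "abs ` set (map u \<rho>) \<subseteq> {1..int m}"
        using x qm by (force simp: au)
      moreover have "length (map u \<rho>) = m" using len p by (simp add: \<rho>_def)
      ultimately have mem: "map u \<rho> \<in> signed_perms m"
        by (simp add: signed_perms_iff)
      have "map (stretch q) (map u \<rho>) = \<rho>"
        using su by (simp add: map_idI)
      moreover have "v = sgn v * int (Suc q)"
        using v(3) by (metis mult_sgn_abs)
      ultimately have "insert_dot (map u \<rho>) p q (sgn v) = \<pi>"
        using p len \<pi>_eq by (simp add: insert_dot_def \<rho>_def)
      moreover have "sgn v \<in> {1, -1}" using v(1) by (auto simp: sgn_if)
      ultimately show "(\<pi>, p) \<in> ?f ` ?A"
        using mem p qm by (intro image_eqI[of _ _ "(map u \<rho>, p, q, sgn v)"]) auto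
    qed
  qed
qed

lemma letter_insert_dot:
  assumes "p \<le> length \<sigma>" "k \<le> Suc (length \<sigma>)"
  shows "letter (insert_dot \<sigma> p q s) k =
    (if k \<le> p then stretch q (letter \<sigma> k)
     else if k = Suc p then s * int (Suc q) else stretch q (letter \<sigma> (k - 1)))"
  using assms
  by (cases k) (auto simp: letter_def insert_dot_def nth_append nth_Cons' min_def)

lemma letter_0 [simp]: "letter \<pi> 0 = 0"
  by (simp add: letter_def)

section \<open>Inversion as transposition of the matrix\<close>

lemma sperm_inverse_letter:
  assumes "\<pi> \<in> signed_perms n"
  shows "sperm_inverse \<pi> \<in> signed_perms n"
    and "i \<in> {1..n} \<Longrightarrow>
      letter (sperm_inverse \<pi>) (nat \<bar>letter \<pi> i\<bar>) = sgn (letter \<pi> i) * int i"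
  using theI'[OF sperm_inverse_ex1[OF assms]] signed_perms_length[OF assms]
  by (simp_all add: sperm_inverse_def)

lemma sperm_inverse_eqI:
  assumes "\<pi> \<in> signed_perms n" "\<sigma> \<in> signed_perms n"
    and "\<And>i. i \<in> {1..n} \<Longrightarrow> letter \<sigma> (nat \<bar>letter \<pi> i\<bar>) = sgn (letter \<pi> i) * int i"
  shows "sperm_inverse \<pi> = \<sigma>"
  using sperm_inverse_ex1[OF assms(1)] sperm_inverse_letter[OF assms(1)] assms by blast

lemma abs_letter:
  assumes "\<pi> \<in> signed_perms n" "i \<in> {1..n}"
  shows "1 \<le> \<bar>letter \<pi> i\<bar>" "\<bar>letter \<pi> i\<bar> \<le> int n"
proof -
  have "letter \<pi> i \<in> set \<pi>"
    using assms by (auto simp: letter_def nth_Cons' signed_perms_iff)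
  then show "1 \<le> \<bar>letter \<pi> i\<bar>" "\<bar>letter \<pi> i\<bar> \<le> int n"
    using assms(1) by (auto simp: signed_perms_iff)
qed

lemma ex_abs_letter:
  assumes "\<pi> \<in> signed_perms n" "k \<in> {1..n}"
  shows "\<exists>i\<in>{1..n}. \<bar>letter \<pi> i\<bar> = int k"
proof -
  have "int k \<in> abs ` set \<pi>"
    using assms by (auto simp: signed_perms_def permutations_of_set_def)
  then obtain i where "i < n" "\<bar>\<pi> ! i\<bar> = int k"
    using assms(1) by (auto simp: in_set_conv_nth signed_perms_iff)
  then show ?thesis by (intro bexI[of _ "Suc i"]) (auto simp: letter_def)
qed

text \<open>The matrix of the inverse is the transpose, with the sign of each entry
  unchanged.\<close>

lemma letter_sperm_inverse_iff:
  assumes "\<pi> \<in> signed_perms n" "p \<in> {1..n}" "q \<in> {1..n}" "s \<in> {1, -1}"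
  shows "s * letter \<pi> p = int q \<longleftrightarrow> s * letter (sperm_inverse \<pi>) q = int p"
proof
  assume *: "s * letter \<pi> p = int q"
  then have "letter \<pi> p = s * int q" using assms(4) by auto
  then show "s * letter (sperm_inverse \<pi>) q = int p"
    using sperm_inverse_letter(2)[OF assms(1,2)] assms by (auto simp: abs_mult sgn_mult)
next
  assume *: "s * letter (sperm_inverse \<pi>) q = int p"
  obtain i where i: "i \<in> {1..n}" "\<bar>letter \<pi> i\<bar> = int q"
    using ex_abs_letter[OF assms(1,3)] by blast
  have "letter (sperm_inverse \<pi>) q = sgn (letter \<pi> i) * int i"
    using sperm_inverse_letter(2)[OF assms(1) i(1)] i(2) by simp
  with * i assms show "s * letter \<pi> p = int q"
    by (auto simp: sgn_if split: if_splits)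
qed

text \<open>In the matrix, an insertion adds a row, a column and the entry \<open>s\<close> where
  they cross; transposing exchanges row and column. Hence increments of \<open>idesB\<close> are
  increments of \<open>desB\<close> for the inverse.\<close>

lemma sperm_inverse_insert_dot:
  assumes "\<sigma> \<in> signed_perms m" "p \<le> m" "q \<le> m" "s \<in> {1, -1}"
  shows "sperm_inverse (insert_dot \<sigma> p q s) = insert_dot (sperm_inverse \<sigma>) q p s"
proof (rule sperm_inverse_eqI)
  let ?\<tau> = "sperm_inverse \<sigma>"
  have s: "\<bar>s\<bar> = 1" "sgn s = s" using assms(4) by auto
  show "insert_dot \<sigma> p q s \<in> signed_perms (Suc m)"
    using assms s by (intro insert_dot_signed_perms) auto
  show "insert_dot ?\<tau> q p s \<in> signed_perms (Suc m)"
    using assms s sperm_inverse_letter by (intro insert_dot_signed_perms) auto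
  have len: "length \<sigma> = m" "length ?\<tau> = m"
    using assms(1) sperm_inverse_letter(1)[OF assms(1)] by (auto simp: signed_perms_iff)
  fix k assume k: "k \<in> {1..Suc m}"
  let ?x = "letter (insert_dot \<sigma> p q s) k"
  show "letter (insert_dot ?\<tau> q p s) (nat \<bar>?x\<bar>) = sgn ?x * int k"
  proof (cases "k = Suc p")
    case True
    then have "?x = s * int (Suc q)" using assms(2) len by (simp add: letter_insert_dot)
    then have "nat \<bar>?x\<bar> = Suc q" "sgn ?x = s" using s by (simp_all add: abs_mult sgn_mult)
    then show ?thesis using True assms(3) len by (simp add: letter_insert_dot)
  next
    case False
    \<comment> \<open>\<open>i\<close> is the position in \<open>\<sigma>\<close> of the letter that
      stands at \<open>k\<close> after the insertion.\<close>
    define i where "i = (if k \<le> p then k else k - 1)"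
    have i: "i \<in> {1..m}" using k False assms(2) by (auto simp: i_def)
    have x: "?x = stretch q (letter \<sigma> i)"
      using False k assms(2) len by (auto simp: letter_insert_dot i_def)
    define j where "j = nat \<bar>letter \<sigma> i\<bar>"
    have j: "\<bar>letter \<sigma> i\<bar> = int j" "1 \<le> j" "j \<le> m"
      using abs_letter[OF assms(1) i] by (auto simp: j_def)
    have "nat \<bar>?x\<bar> = (if q < j then Suc j else j)"
      using j by (auto simp: x abs_stretch)
    then have "letter (insert_dot ?\<tau> q p s) (nat \<bar>?x\<bar>) = stretch p (letter ?\<tau> j)"
      using j assms(3) len by (auto simp: letter_insert_dot)
    also have "letter ?\<tau> j = sgn (letter \<sigma> i) * int i"
      using sperm_inverse_letter(2)[OF assms(1) i] by (simp add: j_def)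
    also have "stretch p \<dots> = sgn ?x * int k"
      using False i j k by (auto simp: x stretch_def i_def abs_mult sgn_mult sgn_if split: if_splits)
    finally show ?thesis .
  qed
qed

section \<open>Change of the descent number under insertion\<close>

lemma desB_eq_sum:
  "int (desB \<pi>) = (\<Sum>k<length \<pi>. of_bool (letter \<pi> (Suc k) < letter \<pi> k))"
proof -
  have "{..<length \<pi>} \<inter> {k. letter \<pi> (Suc k) < letter \<pi> k}
      = {i \<in> {0..<length \<pi>}. letter \<pi> i > letter \<pi> (i + 1)}"
    by auto
  then show ?thesis by (simp add: desB_def)
qed

lemma letter_snoc:
  "letter (\<pi> @ [b]) k = (if k \<le> length \<pi> then letter \<pi> k else letter [b] (k - length \<pi>))"
  by (auto simp: letter_def nth_Cons' nth_append)

lemma letter_snoc_last [simp]: "letter (\<pi> @ [b]) (Suc (length \<pi>)) = b"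
  by (simp add: letter_def)

lemma desB_snoc:
  assumes "letter \<pi> (length \<pi>) \<le> b"
  shows "desB (\<pi> @ [b]) = desB \<pi>"
proof -
  have "int (desB (\<pi> @ [b])) = int (desB \<pi>)"
    using assms by (simp add: desB_eq_sum letter_snoc del: of_nat_eq_iff)
      (simp add: letter_def)
  then show ?thesis by simp
qed

text \<open>Only the pair at gap \<open>p\<close> is affected: it gives way to two pairs through
  \<open>v\<close>. The induction starts at \<open>Suc p\<close>, beyond which both sums gain equal
  terms.\<close>

lemma sum_consecutive_insert:
  fixes h :: "'a \<Rightarrow> 'a \<Rightarrow> 'b::ab_group_add" and f :: "nat \<Rightarrow> 'a" and v :: 'a
  assumes "p < n"
  defines "g \<equiv> \<lambda>k. if k \<le> p then f k else if k = Suc p then v else f (k - 1)"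
  shows "(\<Sum>k<Suc n. h (g k) (g (Suc k))) =
    (\<Sum>k<n. h (f k) (f (Suc k))) + h (f p) v + h v (f (Suc p)) - h (f p) (f (Suc p))"
proof -
  have "Suc p \<le> n" using assms by simp
  then show ?thesis
  proof (induction n rule: dec_induct)
    case base
    have "(\<Sum>k<p. h (g k) (g (Suc k))) = (\<Sum>k<p. h (f k) (f (Suc k)))"
      by (intro sum.cong) (auto simp: g_def)
    then show ?case by (simp add: g_def)
  next
    case (step n)
    then have "g (Suc n) = f n" "g (Suc (Suc n)) = f (Suc n)" by (auto simp: g_def)
    with step.IH show ?case by simp
  qed
qed

text \<open>\<open>stretch q\<close> is strictly increasing and so preserves all old descents; only
  the comparisons with the new letter still mention it.\<close>

lemma desB_insert_dot:
  assumes "p < length \<rho>"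
  shows "int (desB (insert_dot \<rho> p q s)) = int (desB \<rho>)
    + of_bool (s * int (Suc q) < stretch q (letter \<rho> p))
    + of_bool (stretch q (letter \<rho> (Suc p)) < s * int (Suc q))
    - of_bool (letter \<rho> (Suc p) < letter \<rho> p)"
proof -
  let ?f = "\<lambda>k. stretch q (letter \<rho> k)"
  let ?g = "\<lambda>k. if k \<le> p then ?f k else if k = Suc p then s * int (Suc q) else ?f (k - 1)"
  have "int (desB (insert_dot \<rho> p q s)) =
      (\<Sum>k<Suc (length \<rho>). of_bool (?g (Suc k) < ?g k))"
    unfolding desB_eq_sum length_insert_dot
  proof (rule sum.cong[OF refl])
    fix k assume "k \<in> {..<Suc (length \<rho>)}"
    then have "letter (insert_dot \<rho> p q s) k = ?g k"
      "letter (insert_dot \<rho> p q s) (Suc k) = ?g (Suc k)"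
      using assms by (simp_all add: letter_insert_dot del: of_nat_Suc)
    then show "of_bool (letter (insert_dot \<rho> p q s) (Suc k) < letter (insert_dot \<rho> p q s) k)
        = (of_bool (?g (Suc k) < ?g k) :: int)"
      by (simp only:)
  qed
  also note sum_consecutive_insert[OF assms, of "\<lambda>x y. of_bool (y < x)" ?f "s * int (Suc q)"]
  finally show ?thesis
    unfolding strict_mono_less[OF strict_mono_stretch] desB_eq_sum .
qed

text \<open>No stretched letter has absolute value \<open>q + 1\<close>, so each comparison with the
  new letter, or its negation, says on which side of level \<open>q\<close> an unstretched letter
  lies. Multiplying by \<open>s\<close> reflects a negative new letter onto the same levels.\<close>

lemma jump_eq:
  assumes "s \<in> {1, -1::int}"
  shows "of_bool (s * int (Suc q) < stretch q x) + of_bool (stretch q y < s * int (Suc q))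
    = 1 + s * (of_bool (s * y \<le> int q) - of_bool (s * x \<le> int q))"
proof -
  have "int (Suc q) < stretch q x \<longleftrightarrow> \<not> x \<le> int q"
    and "stretch q y < int (Suc q) \<longleftrightarrow> y \<le> int q"
    and "- int (Suc q) < stretch q x \<longleftrightarrow> - x \<le> int q"
    and "stretch q y < - int (Suc q) \<longleftrightarrow> \<not> - y \<le> int q"
    by (auto simp: stretch_def sgn_if)
  then show ?thesis using assms by (auto simp del: of_nat_Suc)
qed

text \<open>By the lemma above, this is the increment of \<open>des\<^sup>B\<close>: the descent of \<open>\<rho>\<close> at the gap \<open>p\<close>, if
  any, is lost, which turns the \<open>1\<close> into the indicator of an ascent.\<close>

definition des_jump :: "int list \<Rightarrow> nat \<Rightarrow> nat \<Rightarrow> int \<Rightarrow> int" where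
  "des_jump \<rho> p q s = of_bool (letter \<rho> p \<le> letter \<rho> (Suc p))
     + s * (of_bool (s * letter \<rho> (Suc p) \<le> int q) - of_bool (s * letter \<rho> p \<le> int q))"

text \<open>At an ascent the signed difference of indicators is \<open>0\<close> or
  \<open>-1\<close>, at a descent \<open>0\<close> or \<open>1\<close>.\<close>

lemma des_jump_01: "s \<in> {1, -1} \<Longrightarrow> des_jump \<rho> p q s \<in> {0, 1}"
  by (auto simp: des_jump_def)

lemma letter_le:
  assumes "\<pi> \<in> signed_perms n" "k \<le> n"
  shows "\<bar>letter \<pi> k\<bar> \<le> int n"
  using abs_letter[OF assms(1), of k] assms(2) by (cases "k = 0") auto

text \<open>The sentinel makes the gap after the last letter an ascent that stays one when a letter is
  stretched or inserted.  It is larger than the levels \<open>q \<le> length \<sigma> + 1\<close> that occur in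
  the telescoping sums.\<close>

definition cap :: "int list \<Rightarrow> int list" where
  "cap \<sigma> = \<sigma> @ [int (length \<sigma>) + 2]"

lemma length_cap [simp]: "length (cap \<sigma>) = Suc (length \<sigma>)"
  by (simp add: cap_def)

lemma desB_cap:
  assumes "\<sigma> \<in> signed_perms m"
  shows "desB (cap \<sigma>) = desB \<sigma>"
proof -
  have "length \<sigma> = m" using assms by (simp add: signed_perms_iff)
  then show ?thesis
    using letter_le[OF assms, of m] unfolding cap_def by (intro desB_snoc) auto
qed

text \<open>The sentinel turns every gap, even the one after the last letter, into a gap between two
  letters, and adds no descent before or after the insertion.\<close>

lemma desB_insert_dot_jump:
  assumes "\<sigma> \<in> signed_perms m" "p \<le> m" "q \<le> m" "s \<in> {1, -1}"
  shows "int (desB (insert_dot \<sigma> p q s)) = int (desB \<sigma>) + des_jump (cap \<sigma>) p q s"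
proof -
  let ?b = "int m + 2"
  have len: "length \<sigma> = m" using assms(1) by (simp add: signed_perms_iff)
  have mem: "insert_dot \<sigma> p q s \<in> signed_perms (Suc m)"
    using assms by (intro insert_dot_signed_perms) auto
  have "letter (insert_dot \<sigma> p q s) (Suc m) \<le> stretch q ?b"
    using letter_le[OF mem, of "Suc m"] by (auto simp: stretch_def abs_le_iff)
  then have "desB (insert_dot \<sigma> p q s) = desB (insert_dot \<sigma> p q s @ [stretch q ?b])"
    using len by (intro desB_snoc[symmetric]) simp
  also have "insert_dot \<sigma> p q s @ [stretch q ?b] = insert_dot (cap \<sigma>) p q s"
    using assms(2) len by (simp add: insert_dot_def cap_def)
  finally have eq: "desB (insert_dot \<sigma> p q s) = desB (insert_dot (cap \<sigma>) p q s)" .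
  have "p < length (cap \<sigma>)" using assms(2) len by simp
  then have "int (desB (insert_dot (cap \<sigma>) p q s)) = int (desB \<sigma>)
      + (1 + s * (of_bool (s * letter (cap \<sigma>) (Suc p) \<le> int q)
              - of_bool (s * letter (cap \<sigma>) p \<le> int q)))
      - of_bool (letter (cap \<sigma>) (Suc p) < letter (cap \<sigma>) p)"
    unfolding jump_eq[OF assms(4), symmetric] by (simp add: desB_insert_dot desB_cap[OF assms(1)])
  moreover have "of_bool (letter (cap \<sigma>) p \<le> letter (cap \<sigma>) (Suc p)) =
      (1 - of_bool (letter (cap \<sigma>) (Suc p) < letter (cap \<sigma>) p) :: int)"
    by auto
  ultimately show ?thesis unfolding eq des_jump_def by linarith
qed

section \<open>Telescoping sums over all insertions\<close>

text \<open>The increments of \<open>X\<close> in \<open>q\<close> and of \<open>Y\<close> in \<open>p\<close> are the same \<open>0/1\<close> matrix \<open>d\<close>.  Hence each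
  summand is the mixed second difference of \<open>X Y\<close> up to terms in \<open>d\<close>.\<close>

lemma sum_mixed_differences:
  fixes X Y d :: "nat \<Rightarrow> nat \<Rightarrow> int"
  assumes X: "\<And>p q. p \<le> n \<Longrightarrow> q < n \<Longrightarrow> X p (Suc q) = X p q + d p (Suc q)"
    and Y: "\<And>p q. p < n \<Longrightarrow> q \<le> n \<Longrightarrow> Y (Suc p) q = Y p q + d (Suc p) q"
    and dX: "\<And>p q. d p q * X p q = d p q" and dY: "\<And>p q. d p q * Y p q = d p q"
    and dd: "\<And>p q. d p q * d p q = d p q"
    and d0: "\<And>p. d p 0 = 0" "\<And>q. d 0 q = 0" "\<And>p. d p n = 0" "\<And>q. d n q = 0"
  shows "(\<Sum>p<n. \<Sum>q<n. (X (Suc p) q - X p q) * (Y p (Suc q) - Y p q)) =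
    X n n * Y n n - X n 0 * Y n 0 - X 0 n * Y 0 n + X 0 0 * Y 0 0 + (\<Sum>p<n. \<Sum>q<n. d p q)"
proof -
  let ?P = "\<lambda>p q. X p q * Y p q"
  have "(X (Suc p) q - X p q) * (Y p (Suc q) - Y p q) =
      (?P (Suc p) (Suc q) - ?P (Suc p) q) - (?P p (Suc q) - ?P p q)
      - d (Suc p) (Suc q) + d (Suc p) q + d p (Suc q)" if "p < n" "q < n" for p q
  proof -
    \<comment> \<open>Both factors fall short of their values at the corner by the same
      \<open>d\<close>; the absorption laws reduce \<open>(X - d) * (Y - d)\<close> to
      \<open>X * Y - d\<close>.\<close>
    have "X (Suc p) q * Y p (Suc q) = ?P (Suc p) (Suc q) - d (Suc p) (Suc q)"
    proof -
      have "X (Suc p) q = X (Suc p) (Suc q) - d (Suc p) (Suc q)"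
        and "Y p (Suc q) = Y (Suc p) (Suc q) - d (Suc p) (Suc q)"
        using X[of "Suc p" q] Y[of p "Suc q"] that by simp_all
      then show ?thesis
        using dX[of "Suc p" "Suc q"] dY[of "Suc p" "Suc q"] dd[of "Suc p" "Suc q"]
        by algebra
    qed
    moreover have "X (Suc p) q * Y p q = ?P (Suc p) q - d (Suc p) q"
      using Y[of p q] dX[of "Suc p" q] that by (simp add: algebra_simps)
    moreover have "X p q * Y p (Suc q) = ?P p (Suc q) - d p (Suc q)"
      using X[of p q] dY[of p "Suc q"] that by (simp add: algebra_simps)
    ultimately show ?thesis by (simp add: algebra_simps)
  qed
  then have split: "(\<Sum>p<n. \<Sum>q<n. (X (Suc p) q - X p q) * (Y p (Suc q) - Y p q)) =
      (\<Sum>p<n. (\<Sum>q<n. ?P (Suc p) (Suc q) - ?P (Suc p) q) - (\<Sum>q<n. ?P p (Suc q) - ?P p q))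
      - (\<Sum>p<n. \<Sum>q<n. d (Suc p) (Suc q)) + (\<Sum>p<n. \<Sum>q<n. d (Suc p) q)
      + (\<Sum>p<n. \<Sum>q<n. d p (Suc q))"
    by (simp add: sum.distrib sum_subtractf)
  have tele: "(\<Sum>p<n. (\<Sum>q<n. ?P (Suc p) (Suc q) - ?P (Suc p) q) - (\<Sum>q<n. ?P p (Suc q) - ?P p q))
      = (?P n n - ?P n 0) - (?P 0 n - ?P 0 0)"
    unfolding sum_lessThan_telescope[of "?P _"]
    by (rule sum_lessThan_telescope[of "\<lambda>p. ?P p n - ?P p 0"])
  \<comment> \<open>\<open>d\<close> vanishes on the border, so shifting an index does not change
    its sums; the three correction sums, with signs \<open>-\<close>, \<open>+\<close>,
    \<open>+\<close>, leave one copy.\<close>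
  have shift: "(\<Sum>q<n. f (Suc q)) = (\<Sum>q<n. f q)" if "f 0 = 0" "f n = 0"
    for f :: "nat \<Rightarrow> int"
    using sum.lessThan_Suc_shift[of f n] that by simp
  have "(\<Sum>p<n. \<Sum>q<n. d p (Suc q)) = (\<Sum>p<n. \<Sum>q<n. d p q)"
    by (intro sum.cong refl shift) (simp_all add: d0)
  moreover have "(\<Sum>p<n. \<Sum>q<n. d (Suc p) (Suc q)) = (\<Sum>p<n. \<Sum>q<n. d (Suc p) q)"
    by (intro sum.cong refl shift) (simp_all add: d0)
  ultimately show ?thesis unfolding split tele by simp
qed

text \<open>The entries equal to \<open>s\<close> in the matrix of \<open>\<sigma>\<close>. The
  bounds keep out \<open>p = q = 0\<close>, where the initial letter \<open>0\<close> would count,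
  and positions beyond the word, where \<open>letter\<close> is unspecified.\<close>

definition dot :: "int list \<Rightarrow> int \<Rightarrow> nat \<Rightarrow> nat \<Rightarrow> int" where
  "dot \<sigma> s p q = of_bool (p \<in> {1..length \<sigma>} \<and> q \<in> {1..length \<sigma>} \<and> s * letter \<sigma> p = int q)"

text \<open>Each of the rows \<open>1\<close> to \<open>m\<close> has exactly one nonzero entry,
  which counts for exactly one sign; row \<open>0\<close> is empty.\<close>

lemma sum_dot:
  assumes "\<sigma> \<in> signed_perms m"
  shows "(\<Sum>p<Suc m. \<Sum>q<Suc m. dot \<sigma> 1 p q) + (\<Sum>p<Suc m. \<Sum>q<Suc m. dot \<sigma> (-1) p q) = int m"
proof -
  have len: "length \<sigma> = m" using assms by (simp add: signed_perms_iff)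
  have "(\<Sum>q<Suc m. dot \<sigma> 1 p q + dot \<sigma> (-1) p q) = of_bool (p \<noteq> 0)"
    if p: "p < Suc m" for p
  proof (cases "p = 0")
    case True
    then show ?thesis by (simp add: dot_def)
  next
    case False
    then have x: "1 \<le> \<bar>letter \<sigma> p\<bar>" "\<bar>letter \<sigma> p\<bar> \<le> int m"
      using abs_letter[OF assms, of p] p by auto
    have "(q \<in> {1..m} \<and> 1 * letter \<sigma> p = int q) = (0 < letter \<sigma> p \<and> q = nat \<bar>letter \<sigma> p\<bar>)"
      and "(q \<in> {1..m} \<and> - 1 * letter \<sigma> p = int q) = (letter \<sigma> p < 0 \<and> q = nat \<bar>letter \<sigma> p\<bar>)" for q
      using x unfolding atLeastAtMost_iff by linarith+
    moreover have "p \<in> {1..m}" using p False by simp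
    ultimately have "dot \<sigma> 1 p q + dot \<sigma> (-1) p q = (if q = nat \<bar>letter \<sigma> p\<bar> then 1 else 0)" for q
      unfolding dot_def len using x(1) by (cases "0 < letter \<sigma> p") simp_all
    moreover have "nat \<bar>letter \<sigma> p\<bar> < Suc m" using x by linarith
    ultimately show ?thesis using False by (simp add: sum.delta del: sum.lessThan_Suc)
  qed
  then have "(\<Sum>p<Suc m. \<Sum>q<Suc m. dot \<sigma> 1 p q + dot \<sigma> (-1) p q) =
      (\<Sum>p<Suc m. of_bool (p \<noteq> 0))"
    by (intro sum.cong) auto
  also have "\<dots> = int m" by (subst sum.lessThan_Suc_shift) simp
  finally show ?thesis by (simp only: sum.distrib)
qed

lemma sum_ascents_cap:
  assumes "\<sigma> \<in> signed_perms m"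
  shows "(\<Sum>p<Suc m. of_bool (letter (cap \<sigma>) p \<le> letter (cap \<sigma>) (Suc p)))
    = int (Suc m) - int (desB \<sigma>)"
proof -
  have len: "length \<sigma> = m" using assms by (simp add: signed_perms_iff)
  have "(\<Sum>p<Suc m. of_bool (letter (cap \<sigma>) p \<le> letter (cap \<sigma>) (Suc p))) =
      (\<Sum>p<Suc m. 1 - of_bool (letter (cap \<sigma>) (Suc p) < letter (cap \<sigma>) p) :: int)"
    by (intro sum.cong) auto
  also have "\<dots> = int (Suc m) - int (desB (cap \<sigma>))"
    unfolding desB_eq_sum sum_subtractf by (simp add: len)
  finally show ?thesis by (simp add: desB_cap[OF assms])
qed

lemma letter_cap:
  assumes "\<sigma> \<in> signed_perms m" "k \<le> Suc m"
  shows "letter (cap \<sigma>) k = (if k = Suc m then int m + 2 else letter \<sigma> k)"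
proof -
  have "length \<sigma> = m" using assms by (simp add: signed_perms_iff)
  then show ?thesis using assms(2) letter_snoc_last[of \<sigma>]
    by (auto simp: cap_def letter_snoc)
qed

text \<open>Only the two ends remain. The initial letter \<open>0\<close> is at most every level;
  the sentinel lies above all of them for \<open>s = 1\<close> and, negated, below all of them for
  \<open>s = -1\<close>.\<close>

lemma sum_level_differences:
  assumes "\<sigma> \<in> signed_perms m" "s \<in> {1, -1}" "q \<le> m"
  shows "(\<Sum>p<Suc m. of_bool (s * letter (cap \<sigma>) (Suc p) \<le> int q)
      - of_bool (s * letter (cap \<sigma>) p \<le> int q)) = (of_bool (s = -1) - 1 :: int)"
  unfolding sum_lessThan_telescope[of "\<lambda>p. of_bool (s * letter (cap \<sigma>) p \<le> int q)"]
  using assms by (auto simp: letter_cap)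

lemma sum_des_jump:
  assumes \<sigma>: "\<sigma> \<in> signed_perms m" and s: "s \<in> {1, -1}"
  shows "(\<Sum>p<Suc m. \<Sum>q<Suc m. des_jump (cap \<sigma>) p q s) =
    int (Suc m) * (int (Suc m) - int (desB \<sigma>)) + s * int (Suc m) * (of_bool (s = -1) - 1)"
proof -
  let ?L = "letter (cap \<sigma>)"
  \<comment> \<open>Summing over \<open>p\<close> at a fixed level \<open>q\<close> lets the
    indicators telescope; the result is the same for every \<open>q\<close>.\<close>
  have "(\<Sum>p<Suc m. des_jump (cap \<sigma>) p q s) =
      int (Suc m) - int (desB \<sigma>) + s * (of_bool (s = -1) - 1)" if "q < Suc m" for q
    using that unfolding des_jump_def sum.distrib sum_distrib_left[symmetric] less_Suc_eq_le
    by (simp only: sum_ascents_cap[OF \<sigma>] sum_level_differences[OF \<sigma> s])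
  then have "(\<Sum>q<Suc m. \<Sum>p<Suc m. des_jump (cap \<sigma>) p q s) =
      (\<Sum>q<Suc m. int (Suc m) - int (desB \<sigma>) + s * (of_bool (s = -1) - 1))"
    by (intro sum.cong) auto
  then show ?thesis
    by (subst sum.swap) (simp add: algebra_simps del: sum.lessThan_Suc)
qed

text \<open>\<open>X\<close> steps in \<open>q\<close>, and \<open>Y\<close> in \<open>p\<close>,
  exactly at the entries \<open>s\<close> of the matrix. For \<open>s = 1\<close> only the corner
  \<open>X 0 0 * Y 0 0 = 1\<close> survives, since the sentinel \<open>m + 2\<close> exceeds the top
  level \<open>m + 1\<close>; for \<open>s = -1\<close> all four corner products are
  \<open>1\<close> and cancel.\<close>

lemma sum_crossings:
  assumes \<sigma>: "\<sigma> \<in> signed_perms m" and s: "s \<in> {1, -1}"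
  defines "X \<equiv> \<lambda>p q. of_bool (s * letter (cap \<sigma>) p \<le> int q) :: int"
    and "Y \<equiv> \<lambda>p q. of_bool (s * letter (cap (sperm_inverse \<sigma>)) q \<le> int p) :: int"
  shows "(\<Sum>p<Suc m. \<Sum>q<Suc m. (X (Suc p) q - X p q) * (Y p (Suc q) - Y p q)) =
    of_bool (s = 1) + (\<Sum>p<Suc m. \<Sum>q<Suc m. dot \<sigma> s p q)"
proof -
  let ?\<tau> = "sperm_inverse \<sigma>"
  have \<tau>: "?\<tau> \<in> signed_perms m" using sperm_inverse_letter(1)[OF \<sigma>] .
  have len: "length \<sigma> = m" "length ?\<tau> = m" using \<sigma> \<tau> by (auto simp: signed_perms_iff)
  have dot_inverse: "dot \<sigma> s p q = dot ?\<tau> s q p" for p q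
    using letter_sperm_inverse_iff[OF \<sigma> _ _ s, of p q] by (auto simp: dot_def len)
  \<comment> \<open>Raising the level from \<open>q\<close> to \<open>q + 1\<close> admits only a
    letter that equals \<open>q + 1\<close> after multiplication by \<open>s\<close>. At the top
    level \<open>m + 1\<close> there is none, in agreement with \<open>dot\<close>.\<close>
  have step: "of_bool (s * letter (cap \<rho>) p \<le> int (Suc q)) =
      of_bool (s * letter (cap \<rho>) p \<le> int q) + dot \<rho> s p (Suc q)"
    if \<rho>: "\<rho> \<in> signed_perms m" and "p \<le> Suc m" "q < Suc m" for \<rho> p q
    using that s letter_le[OF \<rho>, of p] abs_letter[OF \<rho>, of p] \<rho>
    by (cases "p = Suc m"; cases "p = 0")
      (auto simp: letter_cap dot_def signed_perms_iff)
  have level: "dot \<rho> s p q * of_bool (s * letter (cap \<rho>) p \<le> int q) = dot \<rho> s p q"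
    if \<rho>: "\<rho> \<in> signed_perms m" for \<rho> p q
    using \<rho> by (auto simp: dot_def letter_cap signed_perms_iff)
  have "(\<Sum>p<Suc m. \<Sum>q<Suc m. (X (Suc p) q - X p q) * (Y p (Suc q) - Y p q)) =
      X (Suc m) (Suc m) * Y (Suc m) (Suc m) - X (Suc m) 0 * Y (Suc m) 0
      - X 0 (Suc m) * Y 0 (Suc m) + X 0 0 * Y 0 0 + (\<Sum>p<Suc m. \<Sum>q<Suc m. dot \<sigma> s p q)"
  proof (rule sum_mixed_differences)
    show "X p (Suc q) = X p q + dot \<sigma> s p (Suc q)" if "p \<le> Suc m" "q < Suc m" for p q
      unfolding X_def using step[OF \<sigma> that] .
    show "Y (Suc p) q = Y p q + dot \<sigma> s (Suc p) q" if "p < Suc m" "q \<le> Suc m" for p q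
      unfolding Y_def dot_inverse using step[OF \<tau> that(2,1)] .
    show "dot \<sigma> s p q * X p q = dot \<sigma> s p q" for p q
      unfolding X_def using level[OF \<sigma>] .
    show "dot \<sigma> s p q * Y p q = dot \<sigma> s p q" for p q
      unfolding Y_def dot_inverse using level[OF \<tau>] .
  qed (simp_all add: dot_def len)
  also have "X (Suc m) (Suc m) * Y (Suc m) (Suc m) - X (Suc m) 0 * Y (Suc m) 0
      - X 0 (Suc m) * Y 0 (Suc m) + X 0 0 * Y 0 0 = of_bool (s = 1)"
    using s by (auto simp: X_def Y_def letter_cap[OF \<sigma>] letter_cap[OF \<tau>])
  finally show ?thesis .
qed

text \<open>Each increment is an ascent indicator in one index plus \<open>s\<close> times a level
  difference. In the mixed products the ascent indicator is constant along the index in which the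
  level difference telescopes; the product of the two level differences gives the crossing
  sum.\<close>

lemma sum_des_jump_mult:
  assumes \<sigma>: "\<sigma> \<in> signed_perms m" and s: "s \<in> {1, -1}"
  shows "(\<Sum>p<Suc m. \<Sum>q<Suc m. des_jump (cap \<sigma>) p q s * des_jump (cap (sperm_inverse \<sigma>)) q p s) =
    (int (Suc m) - int (desB \<sigma>)) * (int (Suc m) - int (idesB \<sigma>))
    + s * (of_bool (s = -1) - 1) * (2 * int (Suc m) - int (desB \<sigma>) - int (idesB \<sigma>))
    + of_bool (s = 1) + (\<Sum>p<Suc m. \<Sum>q<Suc m. dot \<sigma> s p q)"
proof -
  let ?\<tau> = "sperm_inverse \<sigma>"
  have \<tau>: "?\<tau> \<in> signed_perms m" using sperm_inverse_letter(1)[OF \<sigma>] .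
  define a where "a p = (of_bool (letter (cap \<sigma>) p \<le> letter (cap \<sigma>) (Suc p)) :: int)" for p
  define c where "c q = (of_bool (letter (cap ?\<tau>) q \<le> letter (cap ?\<tau>) (Suc q)) :: int)" for q
  define X where "X p q = (of_bool (s * letter (cap \<sigma>) p \<le> int q) :: int)" for p q
  define Y where "Y p q = (of_bool (s * letter (cap ?\<tau>) q \<le> int p) :: int)" for p q
  let ?A = "\<lambda>p q. X (Suc p) q - X p q" and ?B = "\<lambda>p q. Y p (Suc q) - Y p q"
  have ss: "s * s = 1" using s by auto
  have "des_jump (cap \<sigma>) p q s * des_jump (cap ?\<tau>) q p s =
      a p * c q + s * (a p * ?B p q) + s * (c q * ?A p q) + ?A p q * ?B p q" for p q
  proof -
    have "des_jump (cap \<sigma>) p q s * des_jump (cap ?\<tau>) q p s =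
        (a p + s * ?A p q) * (c q + s * ?B p q)"
      by (simp add: des_jump_def a_def c_def X_def Y_def)
    also have "\<dots> = a p * c q + s * (a p * ?B p q) + s * (c q * ?A p q) + (s * s) * (?A p q * ?B p q)"
      by (simp add: algebra_simps)
    finally show ?thesis by (simp add: ss)
  qed
  then have "(\<Sum>p<Suc m. \<Sum>q<Suc m. des_jump (cap \<sigma>) p q s * des_jump (cap ?\<tau>) q p s) =
      (\<Sum>p<Suc m. \<Sum>q<Suc m. a p * c q) + s * (\<Sum>p<Suc m. a p * (\<Sum>q<Suc m. ?B p q))
      + s * (\<Sum>p<Suc m. \<Sum>q<Suc m. c q * ?A p q) + (\<Sum>p<Suc m. \<Sum>q<Suc m. ?A p q * ?B p q)"
    by (simp only: sum.distrib sum_distrib_left)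
  also have "(\<Sum>p<Suc m. \<Sum>q<Suc m. c q * ?A p q) = (\<Sum>q<Suc m. c q * (\<Sum>p<Suc m. ?A p q))"
    by (subst sum.swap) (simp only: sum_distrib_left)
  also have "(\<Sum>q<Suc m. c q * (\<Sum>p<Suc m. ?A p q)) = (\<Sum>q<Suc m. c q * (of_bool (s = -1) - 1))"
    unfolding X_def
    by (intro sum.cong refl) (simp only: sum_level_differences[OF \<sigma> s] lessThan_iff less_Suc_eq_le)
  also have "(\<Sum>p<Suc m. a p * (\<Sum>q<Suc m. ?B p q)) = (\<Sum>p<Suc m. a p * (of_bool (s = -1) - 1))"
    unfolding Y_def
    by (intro sum.cong refl) (simp only: sum_level_differences[OF \<tau> s] lessThan_iff less_Suc_eq_le)
  also have "(\<Sum>p<Suc m. \<Sum>q<Suc m. ?A p q * ?B p q) =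
      of_bool (s = 1) + (\<Sum>p<Suc m. \<Sum>q<Suc m. dot \<sigma> s p q)"
    unfolding X_def Y_def by (rule sum_crossings[OF \<sigma> s])
  also have "(\<Sum>p<Suc m. \<Sum>q<Suc m. a p * c q) = (\<Sum>p<Suc m. a p) * (\<Sum>q<Suc m. c q)"
    by (rule sum_product[symmetric])
  also have "(\<Sum>p<Suc m. a p * (of_bool (s = -1) - 1)) = (\<Sum>p<Suc m. a p) * (of_bool (s = -1) - 1)"
    by (rule sum_distrib_right[symmetric])
  also have "(\<Sum>p<Suc m. c p * (of_bool (s = -1) - 1)) = (\<Sum>p<Suc m. c p) * (of_bool (s = -1) - 1)"
    by (rule sum_distrib_right[symmetric])
  also have "(\<Sum>p<Suc m. a p) = int (Suc m) - int (desB \<sigma>)"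
    unfolding a_def by (rule sum_ascents_cap[OF \<sigma>])
  also have "(\<Sum>p<Suc m. c p) = int (Suc m) - int (idesB \<sigma>)"
    unfolding c_def idesB_def by (rule sum_ascents_cap[OF \<tau>])
  finally show ?thesis by (simp add: algebra_simps)
qed

section \<open>Counting the insertions into one \<open>\<sigma>\<close> by their effect\<close>

definition dot_cells :: "nat \<Rightarrow> (nat \<times> nat \<times> int) set" where
  "dot_cells m = {..m} \<times> {..m} \<times> {1, -1}"

lemma sum_dot_cells:
  fixes f :: "nat \<Rightarrow> nat \<Rightarrow> int \<Rightarrow> int"
  shows "(\<Sum>(p, q, s)\<in>dot_cells m. f p q s) =
    (\<Sum>p<Suc m. \<Sum>q<Suc m. f p q 1) + (\<Sum>p<Suc m. \<Sum>q<Suc m. f p q (-1))"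
  by (simp add: dot_cells_def lessThan_Suc_atMost sum.distrib
      flip: sum.cartesian_product del: sum.lessThan_Suc sum.atMost_Suc)

text \<open>Both signs are added. The correction \<open>s * (of_bool (s = -1) - 1)\<close> is
  \<open>-1\<close> for \<open>s = 1\<close> and \<open>0\<close> for \<open>s = -1\<close>; the
  final \<open>n\<close> of the third formula collects the corner term \<open>1\<close> and the
  \<open>m\<close> entries of the matrix.\<close>

lemma insert_dot_moments:
  assumes \<sigma>: "\<sigma> \<in> signed_perms m"
  defines "D \<equiv> \<lambda>(p, q, s). des_jump (cap \<sigma>) p q s"
    and "E \<equiv> \<lambda>(p, q, s). des_jump (cap (sperm_inverse \<sigma>)) q p s"
    and "n \<equiv> int (Suc m)" and "i \<equiv> int (desB \<sigma>)" and "j \<equiv> int (idesB \<sigma>)"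
  shows "(\<Sum>x\<in>dot_cells m. D x) = 2 * n * (n - i) - n"
    and "(\<Sum>x\<in>dot_cells m. E x) = 2 * n * (n - j) - n"
    and "(\<Sum>x\<in>dot_cells m. D x * E x) = 2 * (n - i) * (n - j) - (2 * n - i - j) + n"
proof -
  let ?\<tau> = "sperm_inverse \<sigma>"
  have \<tau>: "?\<tau> \<in> signed_perms m" using sperm_inverse_letter(1)[OF \<sigma>] .
  show "(\<Sum>x\<in>dot_cells m. D x) = 2 * n * (n - i) - n"
    unfolding D_def sum_dot_cells n_def i_def
    using sum_des_jump[OF \<sigma>, of 1] sum_des_jump[OF \<sigma>, of "-1"] by (simp add: algebra_simps)
  have swap: "(\<Sum>p<Suc m. \<Sum>q<Suc m. des_jump (cap ?\<tau>) q p s) =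
      (\<Sum>p<Suc m. \<Sum>q<Suc m. des_jump (cap ?\<tau>) p q s)" for s
    by (rule sum.swap)
  show "(\<Sum>x\<in>dot_cells m. E x) = 2 * n * (n - j) - n"
    unfolding E_def sum_dot_cells swap n_def j_def idesB_def
    using sum_des_jump[OF \<tau>, of 1] sum_des_jump[OF \<tau>, of "-1"] by (simp add: algebra_simps)
  have DE: "D x * E x = (case x of (p, q, s) \<Rightarrow>
      des_jump (cap \<sigma>) p q s * des_jump (cap ?\<tau>) q p s)" for x
    by (simp add: D_def E_def split: prod.split)
  show "(\<Sum>x\<in>dot_cells m. D x * E x) = 2 * (n - i) * (n - j) - (2 * n - i - j) + n"
    unfolding DE sum_dot_cells n_def i_def j_def
    using sum_des_jump_mult[OF \<sigma>, of 1] sum_des_jump_mult[OF \<sigma>, of "-1"] sum_dot[OF \<sigma>]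
    by (simp add: algebra_simps del: sum.lessThan_Suc)
qed

lemma bbar_eq_sum:
  "bbar n i j = (\<Sum>\<pi>\<in>signed_perms n. of_bool (int (desB \<pi>) = i \<and> int (idesB \<pi>) = j))"
proof -
  have "{\<pi> \<in> signed_perms n. int (desB \<pi>) = i \<and> int (idesB \<pi>) = j} =
      signed_perms n \<inter> {\<pi>. int (desB \<pi>) = i \<and> int (idesB \<pi>) = j}"
    by auto
  then show ?thesis by (simp add: bbar_def finite_signed_perms)
qed

text \<open>The recurrence in a form for a single \<open>\<sigma>\<close>: the number of cells and
  the three moments determine how many insertions have each joint effect.\<close>

lemma sum_of_bool_insert_dot:
  fixes i j :: int
  assumes \<sigma>: "\<sigma> \<in> signed_perms m"
  defines "n \<equiv> int (Suc m)"
    and "\<delta> \<equiv> \<lambda>a b. of_bool (int (desB \<sigma>) = a \<and> int (idesB \<sigma>) = b) :: int"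
  shows "(\<Sum>(p, q, s)\<in>dot_cells m. of_bool (int (desB (insert_dot \<sigma> p q s)) = i
      \<and> int (idesB (insert_dot \<sigma> p q s)) = j)) =
    (n + i + j + 2 * i * j) * \<delta> i j
    + ((2 * n - 1) * i - (2 * i + 1) * (j - 1)) * \<delta> i (j - 1)
    + ((2 * n - 1) * j - (2 * j + 1) * (i - 1)) * \<delta> (i - 1) j
    + (2 * n\<^sup>2 - n + 2 * (i - 1) * (j - 1) + (1 - 2 * n) * (i + j - 2)) * \<delta> (i - 1) (j - 1)"
proof -
  let ?\<tau> = "sperm_inverse \<sigma>"
  have \<tau>: "?\<tau> \<in> signed_perms m" using sperm_inverse_letter(1)[OF \<sigma>] .
  define D where "D = (\<lambda>(p, q, s). des_jump (cap \<sigma>) p q s)"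
  define E where "E = (\<lambda>(p, q, s). des_jump (cap ?\<tau>) q p s)"
  let ?C = "dot_cells m"
  \<comment> \<open>As \<open>D x\<close> and \<open>E x\<close> are \<open>0\<close> or
    \<open>1\<close>, the four polynomials in them are the indicators of the four joint
    effects.\<close>
  have "(case x of (p, q, s) \<Rightarrow> of_bool (int (desB (insert_dot \<sigma> p q s)) = i
      \<and> int (idesB (insert_dot \<sigma> p q s)) = j)) =
      \<delta> i j * (1 - D x - E x + D x * E x) + \<delta> i (j - 1) * (E x - D x * E x)
      + \<delta> (i - 1) j * (D x - D x * E x) + \<delta> (i - 1) (j - 1) * (D x * E x)"
    if "x \<in> ?C" for x
  proof -
    obtain p q s where "x = (p, q, s)" by (cases x)
    with that have x: "x = (p, q, s)" "p \<le> m" "q \<le> m" "s \<in> {1, -1}"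
      by (simp_all add: dot_cells_def)
    have d: "int (desB (insert_dot \<sigma> p q s)) = int (desB \<sigma>) + D x"
      using desB_insert_dot_jump[OF \<sigma> x(2-4)] by (simp add: D_def x)
    have e: "int (idesB (insert_dot \<sigma> p q s)) = int (idesB \<sigma>) + E x"
      using desB_insert_dot_jump[OF \<tau> x(3,2,4)]
      by (simp add: E_def x idesB_def sperm_inverse_insert_dot[OF \<sigma> x(2-4)])
    have "D x \<in> {0, 1}" "E x \<in> {0, 1}"
      using des_jump_01[OF x(4)] by (simp_all only: D_def E_def x prod.case)
    then show ?thesis
      unfolding x(1) prod.case d[unfolded x(1)] e[unfolded x(1)] \<delta>_def by auto
  qed
  then have eq: "(\<Sum>(p, q, s)\<in>?C. of_bool (int (desB (insert_dot \<sigma> p q s)) = i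
      \<and> int (idesB (insert_dot \<sigma> p q s)) = j)) =
      \<delta> i j * (int (card ?C) - sum D ?C - sum E ?C + (\<Sum>x\<in>?C. D x * E x))
      + \<delta> i (j - 1) * (sum E ?C - (\<Sum>x\<in>?C. D x * E x))
      + \<delta> (i - 1) j * (sum D ?C - (\<Sum>x\<in>?C. D x * E x))
      + \<delta> (i - 1) (j - 1) * (\<Sum>x\<in>?C. D x * E x)"
    by (simp add: sum.distrib sum_subtractf flip: sum_distrib_left)
  have card: "int (card ?C) = 2 * n\<^sup>2"
    by (simp add: dot_cells_def n_def power2_eq_square algebra_simps)
  note moments = insert_dot_moments[OF \<sigma>, folded D_def E_def n_def]
  \<comment> \<open>The factor \<open>\<delta>\<close> allows \<open>desB \<sigma>\<close> and
    \<open>idesB \<sigma>\<close> to be replaced by its arguments, which turns the moments into the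
    coefficients of the recurrence.\<close>
  moreover have "\<delta> i j * (2 * n\<^sup>2 - (2 * n * (n - int (desB \<sigma>)) - n)
      - (2 * n * (n - int (idesB \<sigma>)) - n)
      + (2 * (n - int (desB \<sigma>)) * (n - int (idesB \<sigma>))
        - (2 * n - int (desB \<sigma>) - int (idesB \<sigma>)) + n)) =
      (n + i + j + 2 * i * j) * \<delta> i j"
    by (auto simp: \<delta>_def algebra_simps power2_eq_square)
  moreover have "\<delta> i (j - 1) * (2 * n * (n - int (idesB \<sigma>)) - n
      - (2 * (n - int (desB \<sigma>)) * (n - int (idesB \<sigma>))
        - (2 * n - int (desB \<sigma>) - int (idesB \<sigma>)) + n)) =
      ((2 * n - 1) * i - (2 * i + 1) * (j - 1)) * \<delta> i (j - 1)"
    by (auto simp: \<delta>_def algebra_simps)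
  moreover have "\<delta> (i - 1) j * (2 * n * (n - int (desB \<sigma>)) - n
      - (2 * (n - int (desB \<sigma>)) * (n - int (idesB \<sigma>))
        - (2 * n - int (desB \<sigma>) - int (idesB \<sigma>)) + n)) =
      ((2 * n - 1) * j - (2 * j + 1) * (i - 1)) * \<delta> (i - 1) j"
    by (auto simp: \<delta>_def algebra_simps)
  moreover have "\<delta> (i - 1) (j - 1) * (2 * (n - int (desB \<sigma>)) * (n - int (idesB \<sigma>))
        - (2 * n - int (desB \<sigma>) - int (idesB \<sigma>)) + n) =
      (2 * n\<^sup>2 - n + 2 * (i - 1) * (j - 1) + (1 - 2 * n) * (i + j - 2)) * \<delta> (i - 1) (j - 1)"
    by (auto simp: \<delta>_def algebra_simps power2_eq_square)
  ultimately show ?thesis unfolding eq card moments by (simp only:)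
qed

section \<open>Summation over all signed permutations\<close>

text \<open>The factor \<open>Suc m\<close> chooses the marked letter of the longer permutation; the
  bijection trades marked permutations for insertions.\<close>

lemma bbar_Suc:
  "int (Suc m) * bbar (Suc m) i j =
    (\<Sum>\<sigma>\<in>signed_perms m. \<Sum>(p, q, s)\<in>dot_cells m.
      of_bool (int (desB (insert_dot \<sigma> p q s)) = i \<and> int (idesB (insert_dot \<sigma> p q s)) = j))"
proof -
  let ?w = "\<lambda>\<pi>. of_bool (int (desB \<pi>) = i \<and> int (idesB \<pi>) = j) :: int"
  have "int (Suc m) * bbar (Suc m) i j = (\<Sum>(\<pi>, p)\<in>signed_perms (Suc m) \<times> {..m}. ?w \<pi>)"
    by (simp add: bbar_eq_sum sum_distrib_left flip: sum.cartesian_product)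
  also have "\<dots> = (\<Sum>(\<sigma>, p, q, s)\<in>signed_perms m \<times> dot_cells m. ?w (insert_dot \<sigma> p q s))"
    unfolding dot_cells_def
    by (subst sum.reindex_bij_betw[OF bij_betw_insert_dot, symmetric])
      (intro sum.cong, auto)
  finally show ?thesis by (simp add: case_prod_unfold sum.cartesian_product)
qed

lemma bbar_recurrence:
  fixes m :: nat and i j :: int
  defines "n \<equiv> int (Suc m)"
  shows "n * bbar (Suc m) i j =
    (n + i + j + 2 * i * j) * bbar m i j
    + ((2 * n - 1) * i - (2 * i + 1) * (j - 1)) * bbar m i (j - 1)
    + ((2 * n - 1) * j - (2 * j + 1) * (i - 1)) * bbar m (i - 1) j
    + (2 * n\<^sup>2 - n + 2 * (i - 1) * (j - 1) + (1 - 2 * n) * (i + j - 2)) * bbar m (i - 1) (j - 1)"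
  unfolding n_def bbar_Suc bbar_eq_sum[of m] sum_distrib_left sum.distrib[symmetric]
  by (intro sum.cong refl sum_of_bool_insert_dot)

lemma signed_perms_0: "signed_perms 0 = {[]}"
  by (auto simp: signed_perms_iff)

lemma bbar_0: "bbar 0 i j = of_bool (i = 0 \<and> j = 0)"
proof -
  have "sperm_inverse [] = []"
    using sperm_inverse_letter(1)[of "[]" 0] by (simp add: signed_perms_0)
  then show ?thesis by (simp add: bbar_eq_sum signed_perms_0 idesB_def desB_def)
qed

theorem theorem1p2:
  shows "bbar 1 0 0 = 1 \<and> bbar 1 1 1 = 1 \<and> bbar 1 0 1 = 0 \<and> bbar 1 1 0 = 0 \<and>
    (\<forall>(n::nat) (i::int) (j::int).
       2 \<le> n \<and> 0 \<le> i \<and> i \<le> int n \<and> 0 \<le> j \<and> j \<le> int n \<longrightarrow>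
       int n * bbar n i j =
         (int n + i + j + 2 * i * j) * bbar (n - 1) i j
       + ((2 * int n - 1) * i - (2 * i + 1) * (j - 1)) * bbar (n - 1) i (j - 1)
       + ((2 * int n - 1) * j - (2 * j + 1) * (i - 1)) * bbar (n - 1) (i - 1) j
       + ((2 * (int n)^2 - int n) + 2 * (i - 1) * (j - 1) + (1 - 2 * int n) * (i + j - 2))
           * bbar (n - 1) (i - 1) (j - 1))"
proof (intro conjI allI impI)
  \<comment> \<open>The values for length \<open>1\<close> come from the recurrence as well, applied
    to the empty word.\<close>
  note b1 = bbar_recurrence[of 0]
  show "bbar 1 0 0 = 1" "bbar 1 1 1 = 1" "bbar 1 0 1 = 0" "bbar 1 1 0 = 0"
    using b1[of 0 0] b1[of 1 1] b1[of 0 1] b1[of 1 0] by (simp_all add: bbar_0)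
next
  fix n :: nat and i j :: int
  assume "2 \<le> n \<and> 0 \<le> i \<and> i \<le> int n \<and> 0 \<le> j \<and> j \<le> int n"
  then have "n = Suc (n - 1)" by simp
  then show "int n * bbar n i j =
         (int n + i + j + 2 * i * j) * bbar (n - 1) i j
       + ((2 * int n - 1) * i - (2 * i + 1) * (j - 1)) * bbar (n - 1) i (j - 1)
       + ((2 * int n - 1) * j - (2 * j + 1) * (i - 1)) * bbar (n - 1) (i - 1) j
       + ((2 * (int n)^2 - int n) + 2 * (i - 1) * (j - 1) + (1 - 2 * int n) * (i + j - 2))
           * bbar (n - 1) (i - 1) (j - 1)"
    using bbar_recurrence[of "n - 1" i j] by simp
qed

end
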